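(* Let $l \geq 1$ be an integer and let $F$ be a monotone $l$-regular CNF formula with $|F| \not\equiv 0 \pmod{l}$. Then $F$ is x-unsat.
   Context: A monotone CNF formula $F$ is a finite non-empty set (conjunction) of clauses in which every clause is a finite non-empty set (disjunction) of positive literals, i.e. of (unnegated) Boolean variables. $|F|$ is the number of clauses and $V(F)$ the set of variables occurring in $F$. $F$ is $l$-regular if every variable $x \in V(F)$ occurs in exactly $l$ clauses of $F$. $F$ is x-sat if there is a truth assignment $V(F) \to \{0,1\}$ under which exactly one literal in each clause of $F$ is true; otherwise $F$ is x-unsat. *)

theory Defs
  imports "HOL-Number_Theory.Cong"
begin

text \<open>All literals of a monotone formula are positive, so a literal is identified with its
  variable, a clause with a set of variables, and a formula with a set of such sets.\<close>

definition monotone_cnf :: "'v set set \<Rightarrow> bool" where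
  "monotone_cnf F \<longleftrightarrow> finite F \<and> F \<noteq> {} \<and> (\<forall>C\<in>F. finite C \<and> C \<noteq> {})"

definition vars :: "'v set set \<Rightarrow> 'v set" where
  "vars F = \<Union> F"

definition regular_cnf :: "nat \<Rightarrow> 'v set set \<Rightarrow> bool" where
  "regular_cnf l F \<longleftrightarrow> (\<forall>x\<in>vars F. card {C \<in> F. x \<in> C} = l)"

text \<open>Truth assignments are total functions; only their values on \<open>vars F\<close> are
  inspected, so this is the same as quantifying over functions on \<open>vars F\<close>.\<close>

definition x_sat :: "'v set set \<Rightarrow> bool" where
  "x_sat F \<longleftrightarrow> (\<exists>\<alpha> :: 'v \<Rightarrow> bool. \<forall>C\<in>F. \<exists>!x. x \<in> C \<and> \<alpha> x)"

definition x_unsat :: "'v set set \<Rightarrow> bool" where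
  "x_unsat F \<longleftrightarrow> \<not> x_sat F"

end

theory Submission
  imports Defs
begin

text \<open>Double counting. If an assignment makes exactly one literal true in each clause, let T
  be the set of true variables and count the pairs (C, x) with x in both C and T. Each clause
  contributes one pair, giving |F|; by regularity each variable of T contributes l, giving l * |T|.
  Hence l divides |F|.\<close>

theorem theorem4:
  fixes l :: nat and F :: "'v set set"
  assumes "l \<ge> 1"
    and "monotone_cnf F"
    and "regular_cnf l F"
    and "\<not> [card F = 0] (mod l)"
  shows "x_unsat F"
  unfolding x_unsat_def
proof
  assume "x_sat F"
  then obtain \<alpha> where \<alpha>: "\<forall>C\<in>F. \<exists>!x. x \<in> C \<and> \<alpha> x"
    unfolding x_sat_def ..
  \<comment> \<open>As \<alpha> is total, it may be true outside \<open>vars F\<close>; the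
    restriction makes \<open>T\<close> finite and lets regularity apply to all its elements.\<close>
  define T where "T = {x \<in> vars F. \<alpha> x}"
  have fin: "finite F" "finite T"
    using assms(2) by (auto simp: monotone_cnf_def vars_def T_def)
  have "card {x \<in> T. x \<in> C} = 1" if "C \<in> F" for C
  proof -
    obtain x where x: "x \<in> C" "\<alpha> x" "\<And>y. y \<in> C \<Longrightarrow> \<alpha> y \<Longrightarrow> y = x"
      using \<alpha> \<open>C \<in> F\<close> by metis
    then have "{x \<in> T. x \<in> C} = {x}"
      using \<open>C \<in> F\<close> unfolding T_def vars_def by blast
    then show ?thesis by simp
  qed
  then have "card F = (\<Sum>C\<in>F. card {x \<in> T. x \<in> C})"
    by simp
  \<comment> \<open>The same pairs counted by variable: each element of \<open>T\<close> lies in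
    exactly \<open>l\<close> clauses.\<close>
  also have "\<dots> = l * card T"
    using fin assms(3) by (intro sum_multicount) (auto simp: regular_cnf_def T_def)
  finally show False
    using assms(4) by (simp add: cong_0_iff)
qed

end
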